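(* $$\int_0^1 \ln(-\ln x)\,\frac{1}{1+x}\,dx = -\frac12(\ln 2)^2.$$ *)

theory Defs
  imports "HOL-Analysis.Analysis"
begin

end

theory Submission
  imports Defs "HOL-Real_Asymp.Real_Asymp"
begin

text \<open>
  Since \<open>1 / (1 + x) = 1 / (1 - x) - 2 * x / (1 - x\<^sup>2)\<close> and
  \<open>ln (- ln (x\<^sup>2)) = ln 2 + ln (- ln x)\<close>, a primitive \<open>H\<close> of \<open>ln (- ln u) / (1 - u)\<close> gives the
  primitive \<open>H x - H (x\<^sup>2) - ln 2 * ln (1 - x\<^sup>2)\<close> of the integrand.  Splitting
  \<open>H u = D u - (ln (1 - u))\<^sup>2 / 2\<close> leaves a \<open>D\<close> with
  \<open>0 \<le> D' u \<le> - ln u / (1 - u)\<close>, so \<open>0 \<le> D x - D (x\<^sup>2) \<le> - 2 * x * ln x\<close> vanishes at both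
  endpoints, and the remaining part of the primitive is explicit.
\<close>

text \<open>Extending \<open>F\<close> by its one-sided limits \<open>A\<close> and \<open>B\<close>
  makes it continuous on the closed interval, so the fundamental theorem with derivatives only in
  the interior applies; the two endpoints do not affect the integral.\<close>

lemma has_integral_Ioo_of_limits:
  fixes f F :: "real \<Rightarrow> real"
  assumes "a < b"
    and deriv: "\<And>x. x \<in> {a<..<b} \<Longrightarrow> (F has_real_derivative f x) (at x)"
    and lim_a: "(F \<longlongrightarrow> A) (at_right a)"
    and lim_b: "(F \<longlongrightarrow> B) (at_left b)"
  shows "(f has_integral (B - A)) {a<..<b}"
proof -
  define G where "G = (\<lambda>x. if x = a then A else if x = b then B else F x)"
  have G_deriv: "(G has_real_derivative f x) (at x)" if "x \<in> {a<..<b}" for x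
    by (rule has_field_derivative_transform_within_open[OF deriv[OF that], of "{a<..<b}"])
      (use that in \<open>auto simp: G_def\<close>)
  have "(G \<longlongrightarrow> A) (at_right a)"
    using lim_a by (rule Lim_transform_eventually)
      (use \<open>a < b\<close> in \<open>auto simp: G_def eventually_at_right intro!: exI[of _ b]\<close>)
  moreover have "(G \<longlongrightarrow> B) (at_left b)"
    using lim_b by (rule Lim_transform_eventually)
      (use \<open>a < b\<close> in \<open>auto simp: G_def eventually_at_left intro!: exI[of _ a]\<close>)
  moreover have "isCont G x" if "x \<in> {a<..<b}" for x
    using G_deriv[OF that] by (rule DERIV_isCont)
  ultimately have "continuous_on {a..b} G"
    using \<open>a < b\<close> by (intro continuous_on_IccI) (auto simp: G_def isCont_def)
  then have "(f has_integral (G b - G a)) {a..b}"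
    using \<open>a < b\<close> G_deriv
    by (intro fundamental_theorem_of_calculus_interior)
      (auto simp: has_real_derivative_iff_has_vector_derivative)
  then show ?thesis
    using \<open>a < b\<close> by (simp add: G_def has_integral_Icc_iff_Ioo)
qed

text \<open>Applying \<open>ln t \<le> t - 1\<close> at \<open>t = u\<close> and at
  \<open>t = 1 / u\<close> gives \<open>1 - u \<le> - ln u \<le> (1 - u) / u\<close>; then take
  logarithms.\<close>

lemma ln_ratio_bounds:
  fixes u :: real
  assumes "0 < u" "u < 1"
  shows "0 \<le> ln (- ln u) - ln (1 - u)" "ln (- ln u) - ln (1 - u) \<le> - ln u"
proof -
  have "1 - u \<le> - ln u"
    using ln_le_minus_one[of u] assms by simp
  then show "0 \<le> ln (- ln u) - ln (1 - u)"
    using assms by simp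
  have "- ln u \<le> (1 - u) / u"
    using ln_le_minus_one[of "1 / u"] assms by (simp add: ln_div field_simps)
  then have "ln (- ln u) \<le> ln ((1 - u) / u)"
    using assms by (subst ln_le_cancel_iff) auto
  then show "ln (- ln u) - ln (1 - u) \<le> - ln u"
    using assms by (simp add: ln_div)
qed

lemma ln_minus_ln_square:
  fixes x :: real
  assumes "0 < x" "x < 1"
  shows "ln (- ln (x\<^sup>2)) = ln 2 + ln (- ln x)"
  using assms ln_mult[of 2 "- ln x"] by (simp add: ln_realpow)

theorem corollary2p1:
  "((\<lambda>x::real. ln (- ln x) * (1 / (1 + x))) has_integral (- (1 / 2) * (ln 2)\<^sup>2)) {0<..<1}"
proof -
  define d where "d = (\<lambda>u::real. (ln (- ln u) - ln (1 - u)) / (1 - u))"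
  \<comment> \<open>Continuity of \<open>d\<close> on the open unit interval yields a primitive
    without a closed form; only differences of its values enter below.\<close>
  have "\<exists>D. \<forall>u. ereal 0 < ereal u \<longrightarrow> ereal u < ereal 1 \<longrightarrow> (D has_vector_derivative d u) (at u)"
    by (rule einterval_antiderivative) (auto simp: d_def intro!: continuous_intros)
  then obtain D where D: "\<And>u. \<lbrakk>0 < u; u < 1\<rbrakk> \<Longrightarrow> (D has_real_derivative d u) (at u)"
    by (auto simp: has_real_derivative_iff_has_vector_derivative)
  define R where "R = (\<lambda>x. D x - D (x\<^sup>2))"
  \<comment> \<open>The explicit part of the primitive: the terms of
    \<open>H x - H (x\<^sup>2)\<close> coming from \<open>- (ln (1 - u))\<^sup>2 / 2\<close>,
    together with the \<open>ln 2\<close> correction.\<close>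
  define E where "E = (\<lambda>x::real. - (ln (1 - x))\<^sup>2 / 2 + (ln (1 - x\<^sup>2))\<^sup>2 / 2 - ln 2 * ln (1 - x\<^sup>2))"

  have sq: "0 < x\<^sup>2" "x\<^sup>2 < x" "x\<^sup>2 < 1" if "0 < x" "x < 1" for x :: real
    using that by (auto simp: power2_eq_square mult_less_cancel_left1 mult_less_cancel_left2
        intro: mult_strict_mono[of x 1 x 1, simplified])
  have R_bounds: "0 \<le> R x \<and> R x \<le> - 2 * x * ln x" if x: "0 < x" "x < 1" for x
  proof -
    \<comment> \<open>Mean value theorem for \<open>D\<close> on the interval from
      \<open>x\<^sup>2\<close> to \<open>x\<close>.\<close>
    obtain u where u: "x\<^sup>2 < u" "u < x" and R_eq: "R x = (x - x\<^sup>2) * d u"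
    proof -
      have "\<exists>u>x\<^sup>2. u < x \<and> D x - D (x\<^sup>2) = (x - x\<^sup>2) * d u"
      proof (rule MVT2)
        show "(D has_real_derivative d u) (at u)" if "x\<^sup>2 \<le> u" "u \<le> x" for u
          by (rule D) (use that x sq[OF x] in linarith)+
      qed (rule sq[OF x])
      then show ?thesis
        using that by (auto simp: R_def)
    qed
    have u01: "0 < u" "u < 1"
      using u x sq[OF x] by linarith+
    \<comment> \<open>The location of \<open>u\<close> turns the bound on \<open>d u\<close> into
      one in \<open>x\<close> alone: \<open>- ln u \<le> - 2 * ln x\<close> and
      \<open>1 - x \<le> 1 - u\<close>. The length \<open>x - x\<^sup>2 = x * (1 - x)\<close> then
      cancels the denominator.\<close>
    have "ln (x\<^sup>2) \<le> ln u"
      by (subst ln_le_cancel_iff) (use u u01 sq[OF x] in linarith)+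
    then have "ln (- ln u) - ln (1 - u) \<le> - 2 * ln x"
      using ln_ratio_bounds(2)[OF u01] x by (simp add: ln_realpow)
    then have d_le: "d u \<le> (- 2 * ln x) / (1 - x)"
      unfolding d_def using u u01 x by (intro frac_le) auto
    have "0 \<le> d u"
      unfolding d_def using ln_ratio_bounds(1)[OF u01] u01 by simp
    moreover have "(x - x\<^sup>2) * d u \<le> (x - x\<^sup>2) * ((- 2 * ln x) / (1 - x))"
      using d_le sq[OF x] by (intro mult_left_mono) auto
    moreover have "(x - x\<^sup>2) * ((- 2 * ln x) / (1 - x)) = - 2 * x * ln x"
      using x by (simp add: field_simps power2_eq_square)
    ultimately show ?thesis
      using R_eq sq[OF x] by simp
  qed

  have R_lim: "(R \<longlongrightarrow> 0) F"
    if "\<forall>\<^sub>F x in F. 0 < x \<and> x < 1" "((\<lambda>x. - 2 * x * ln x) \<longlongrightarrow> 0) F" for F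
    by (rule tendsto_sandwich[OF _ _ tendsto_const that(2)])
      (use that(1) in \<open>auto elim!: eventually_mono dest: R_bounds\<close>)
  have "(R \<longlongrightarrow> 0) (at_right 0)"
  proof (rule R_lim)
    show "\<forall>\<^sub>F x in at_right (0::real). 0 < x \<and> x < 1"
      using eventually_at_right_real[of 0 1] by simp
    show "((\<lambda>x::real. - 2 * x * ln x) \<longlongrightarrow> 0) (at_right 0)"
      by real_asymp
  qed
  moreover have "(E \<longlongrightarrow> 0) (at_right 0)"
    unfolding E_def by real_asymp
  ultimately have lim0: "((\<lambda>x. R x + E x) \<longlongrightarrow> 0) (at_right 0)"
    using tendsto_add by force
  have "(R \<longlongrightarrow> 0) (at_left 1)"
  proof (rule R_lim)
    show "\<forall>\<^sub>F x in at_left (1::real). 0 < x \<and> x < 1"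
      using eventually_at_left_real[of 0 1] by simp
    show "((\<lambda>x::real. - 2 * x * ln x) \<longlongrightarrow> 0) (at_left 1)"
      by real_asymp
  qed
  moreover have "(E \<longlongrightarrow> - (1 / 2) * (ln 2)\<^sup>2) (at_left 1)"
  \<comment> \<open>Both squares in \<open>E\<close> diverge at 1. Splitting
    \<open>ln (1 - x\<^sup>2)\<close> into \<open>ln (1 - x) + ln (1 + x)\<close> cancels
    \<open>(ln (1 - x))\<^sup>2\<close> and leaves \<open>ln (1 - x)\<close> times a factor
    vanishing at 1; the other terms tend to
    \<open>(ln 2)\<^sup>2 / 2 - (ln 2)\<^sup>2\<close>.\<close>
  proof (rule Lim_transform_eventually)
    show "((\<lambda>x. ln (1 - x) * (ln (1 + x) - ln 2) + (ln (1 + x))\<^sup>2 / 2 - ln 2 * ln (1 + x))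
        \<longlongrightarrow> - (1 / 2) * (ln 2)\<^sup>2) (at_left (1::real))"
      by (real_asymp simp: power2_eq_square)
    have "ln (1 - x) * (ln (1 + x) - ln 2) + (ln (1 + x))\<^sup>2 / 2 - ln 2 * ln (1 + x) = E x"
      if "0 < x" "x < 1" for x :: real
    proof -
      have "ln (1 - x\<^sup>2) = ln (1 - x) + ln (1 + x)"
        using that ln_mult[of "1 - x" "1 + x"] by (simp add: algebra_simps power2_eq_square)
      then show ?thesis
        by (simp add: E_def field_simps power2_eq_square)
    qed
    then show "\<forall>\<^sub>F x in at_left (1::real).
        ln (1 - x) * (ln (1 + x) - ln 2) + (ln (1 + x))\<^sup>2 / 2 - ln 2 * ln (1 + x) = E x"
      using eventually_at_left_real[of 0 1] by (auto elim!: eventually_mono)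
  qed
  ultimately have lim1: "((\<lambda>x. R x + E x) \<longlongrightarrow> - (1 / 2) * (ln 2)\<^sup>2) (at_left 1)"
    using tendsto_add by force

  have "((\<lambda>x. R x + E x) has_real_derivative ln (- ln x) * (1 / (1 + x))) (at x)"
    if x: "0 < x" "x < 1" for x
  proof -
    have "((\<lambda>x. D (x\<^sup>2)) has_real_derivative d (x\<^sup>2) * (2 * x)) (at x)"
      by (rule DERIV_chain2[OF D]) (use sq[OF x] in \<open>auto intro!: derivative_eq_intros\<close>)
    then have R': "(R has_real_derivative d x - d (x\<^sup>2) * (2 * x)) (at x)"
      unfolding R_def using D x by (intro DERIV_diff) auto
    have E': "(E has_real_derivative
        ln (1 - x) / (1 - x) - ln (1 - x\<^sup>2) * (2 * x) / (1 - x\<^sup>2) + ln 2 * (2 * x) / (1 - x\<^sup>2)) (at x)"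
      unfolding E_def using x sq[OF x]
      by (auto intro!: derivative_eq_intros simp: divide_simps)
    define l where "l = ln (- ln x)"
    have fact: "1 - x\<^sup>2 = (1 - x) * (1 + x)"
      by (simp add: algebra_simps power2_eq_square)
    \<comment> \<open>All terms in \<open>ln (1 - x)\<close>, \<open>ln (1 - x\<^sup>2)\<close> and
      \<open>ln 2\<close> cancel, leaving only multiples of \<open>l\<close>.\<close>
    have "d x - d (x\<^sup>2) * (2 * x) +
        (ln (1 - x) / (1 - x) - ln (1 - x\<^sup>2) * (2 * x) / (1 - x\<^sup>2) + ln 2 * (2 * x) / (1 - x\<^sup>2))
        = l / (1 - x) - l * (2 * x) / (1 - x\<^sup>2)"
      unfolding d_def ln_minus_ln_square[OF x] l_def[symmetric]
      by (simp add: diff_divide_distrib add_divide_distrib algebra_simps)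
    also have "\<dots> = l * (1 / (1 + x))"
      unfolding fact using x by (simp add: divide_simps) (simp add: algebra_simps)
    finally show ?thesis
      using DERIV_add[OF R' E'] by (simp add: l_def)
  qed
  then show ?thesis
    using has_integral_Ioo_of_limits[OF _ _ lim0 lim1] by simp
qed

end
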